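(* For every integer $n\ge 3$, the geometric domination number $D_n$ of the $n\times n$ grid satisfies $D_n \le 2\left\lceil \frac n2\right\rceil$.
   Context: The $n\times n$ grid is $\{1,\dots,n\}\times\{1,\dots,n\}$. Three points are collinear if they lie on a common straight line in the plane. A point $p$ of the grid is dominated by a subset $S$ of the grid if $p\in S$ or there exist two distinct points $x,y\in S$ such that $x,y,p$ are collinear. A subset $S$ of the grid is a (geometric) dominating set if every point of the grid is dominated by $S$. The (geometric) domination number $D_n$ is the smallest size of a dominating set of the $n\times n$ grid. *)

theory Defs
  imports "HOL-Analysis.Analysis"
begin

(* The grid is embedded in the real plane so that collinearity is the library's
   collinear predicate. *)
definition grid :: "nat \<Rightarrow> (real \<times> real) set" where
  "grid n = real ` {1..n} \<times> real ` {1..n}"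

definition dominated :: "(real \<times> real) set \<Rightarrow> real \<times> real \<Rightarrow> bool" where
  "dominated S p \<longleftrightarrow> p \<in> S \<or> (\<exists>x\<in>S. \<exists>y\<in>S. x \<noteq> y \<and> collinear {x, y, p})"

definition dominating_set :: "nat \<Rightarrow> (real \<times> real) set \<Rightarrow> bool" where
  "dominating_set n S \<longleftrightarrow> S \<subseteq> grid n \<and> (\<forall>p\<in>grid n. dominated S p)"

(* The minimum is over a nonempty set of values: the grid dominates itself. All
   dominating sets are finite, being subsets of the grid, so card is their size. *)
definition domination_number :: "nat \<Rightarrow> nat" where
  "domination_number n = (LEAST k. \<exists>S. dominating_set n S \<and> card S = k)"

end

theory Submission
  imports Defs
begin

text \<open>
  Put \<open>m = \<lceil>n / 2\<rceil>\<close> and \<open>S = {m, m + 1} \<times> {2..m + 1}\<close>, so \<open>card S = 2 m\<close>. The two columns of \<open>S\<close> are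
  dominated because \<open>m \<ge> 2\<close>. Let \<open>p\<close> be a grid point at height \<open>y\<close> and horizontal distance \<open>s \<ge> 1\<close>
  from the nearer of the two columns; then \<open>s \<le> m - 1\<close>. A line through \<open>p\<close> of integer slope \<open>\<plusminus>j\<close> meets
  the columns at heights \<open>y - s j\<close> and \<open>y - (s + 1) j\<close>. If \<open>y\<close> exceeds \<open>m + 1\<close> by
  \<open>d \<le> m - 1\<close>, the least \<open>j\<close> with \<open>s j \<ge> d\<close> brings both heights into \<open>{2..m + 1}\<close>, because
  \<open>s (m - s) \<ge> m - 1\<close>. Otherwise \<open>j = 0\<close> works, or \<open>j = - 1\<close> if \<open>y = 1\<close>.
\<close>

lemma collinear_affine_triple:
  fixes a b e f t :: real
  shows "collinear {(a, b), (a + e, b + f), (a + t * e, b + t * f)}"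
  unfolding collinear_alt
proof (rule exI, rule exI, rule ballI)
  fix p
  assume "p \<in> {(a, b), (a + e, b + f), (a + t * e, b + t * f)}"
  then have "p = (a, b) + 0 *\<^sub>R (e, f) \<or> p = (a, b) + 1 *\<^sub>R (e, f) \<or> p = (a, b) + t *\<^sub>R (e, f)"
    by auto
  then show "\<exists>c. p = (a, b) + c *\<^sub>R (e, f)"
    by blast
qed

lemma exists_slope:
  fixes m s y :: int
  assumes "1 \<le> s" "s \<le> m - 1" "1 \<le> y" "y \<le> 2 * m"
  shows "\<exists>j. y - s * j \<in> {2..m + 1} \<and> y - (s + 1) * j \<in> {2..m + 1}"
proof -
  consider "y = 1" | "y \<in> {2..m + 1}" | "y > m + 1"
    using assms by force
  then show ?thesis
  proof cases
    case 1
    \<comment> \<open>The heights are \<open>s + 1\<close> and \<open>s + 2\<close>, in range since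
      1 \<le> \<open>s\<close> \<le> \<open>m - 1\<close>.\<close>
    then show ?thesis
      using assms by (intro exI[of _ "-1"]) auto
  next
    case 2
    then show ?thesis
      by (intro exI[of _ 0]) auto
  next
    case 3
    define d where "d = y - m - 1"
    \<comment> \<open>This is \<open>d / s\<close> rounded up.\<close>
    define j where "j = (d + s - 1) div s"
    have d: "1 \<le> d" "d \<le> m - 1"
      using 3 assms by (auto simp: d_def)
    have "s * j + (d + s - 1) mod s = d + s - 1"
      by (simp add: j_def)
    moreover have "0 \<le> (d + s - 1) mod s" "(d + s - 1) mod s < s"
      using assms by simp_all
    ultimately have j: "d \<le> s * j" "s * j \<le> d + s - 1"
      by linarith+
    have "0 \<le> (s - 1) * (m - 1 - s)"
      using assms by simp
    then have "m - 1 \<le> s * (m - s)"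
      by (simp add: algebra_simps)
    \<comment> \<open>Chain: \<open>s * (j - 1)\<close> \<le> \<open>d - 1\<close> <
      \<open>m - 1\<close> \<le> \<open>s * (m - s)\<close>. The resulting bound
      \<open>j \<le> m - s\<close> keeps the lower height at least 2, because the upper one is at
      least \<open>m + 2 - s\<close>.\<close>
    then have "s * (j - 1) < s * (m - s)"
      using j d by (simp add: algebra_simps)
    then have "j \<le> m - s"
      using assms by (simp add: mult_less_cancel_left)
    moreover have "0 \<le> j"
      using assms d by (simp add: j_def pos_imp_zdiv_nonneg_iff)
    ultimately show ?thesis
      using j by (intro exI[of _ j]) (auto simp: d_def algebra_simps)
  qed
qed

lemma mem_real_image_atLeastAtMost:
  assumes "i \<in> {int a..int b}"
  shows "real_of_int i \<in> real ` {a..b}"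
  using assms by (intro image_eqI[of _ _ "nat i"]) auto

lemma dominating_set_two_columns:
  assumes "2 \<le> m" "m + 1 \<le> n" "n \<le> 2 * m"
  shows "dominating_set n (real ` {m, m + 1} \<times> real ` {2..m + 1})"
    (is "dominating_set n ?S")
proof -
  have "dominated ?S (real x, real y)" if x: "x \<in> {1..n}" and y: "y \<in> {1..n}" for x y
  proof (cases "x \<in> {m, m + 1}")
    case True
    have "collinear {(real x, 2), (real x, 3), (real x, real y)}"
      using collinear_affine_triple[of "real x" 2 0 1 "real y - 2"] by simp
    moreover have "(real x, 2) \<in> ?S" "(real x, 3) \<in> ?S"
      using True assms
        mem_real_image_atLeastAtMost[of 2 2 "m + 1"] mem_real_image_atLeastAtMost[of 3 2 "m + 1"]
      by auto
    ultimately show ?thesis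
      unfolding dominated_def by (metis numeral_eq_iff num.distinct(5) prod.inject)
  next
    case False
    define s where "s = (if x < m then int m - int x else int x - int m - 1)"
    have "1 \<le> s" "s \<le> int m - 1"
      using False x assms by (auto simp: s_def)
    moreover have "1 \<le> int y" "int y \<le> 2 * int m"
      using y assms by auto
    ultimately obtain j where
      j: "int y - s * j \<in> {2..int m + 1}" "int y - (s + 1) * j \<in> {2..int m + 1}"
      using exists_slope by blast
    define v u where "v = int y - s * j" and "u = int y - (s + 1) * j"
    have vu: "real_of_int v \<in> real ` {2..m + 1}" "real_of_int u \<in> real ` {2..m + 1}"
      using j unfolding v_def u_def by (intro mem_real_image_atLeastAtMost; simp)+
    define near far where "near = (if x < m then m else m + 1)"
      and "far = (if x < m then m + 1 else m)"
    have *: "(real near, real_of_int v) \<in> ?S" "(real far, real_of_int u) \<in> ?S" "near \<noteq> far"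
      using vu by (auto simp: near_def far_def)
    \<comment> \<open>The step from the far column to the near one is a unit step towards
      \<open>x\<close>, so \<open>s + 1\<close> such steps from the far point reach
      \<open>(x, y)\<close>.\<close>
    have "real far + (s + 1) * (real near - real far) = real x"
      using False by (auto simp: near_def far_def s_def)
    moreover have "u + (s + 1) * (v - u) = y"
      by (simp add: u_def v_def algebra_simps)
    then have "real_of_int u + (s + 1) * (real_of_int v - real_of_int u) = real y"
      by (metis of_int_add of_int_diff of_int_mult of_int_1 of_int_of_nat_eq)
    ultimately have
      "collinear {(real far, real_of_int u), (real near, real_of_int v), (real x, real y)}"
      using collinear_affine_triple[of "real far" "real_of_int u" "real near - real far"
          "real_of_int v - real_of_int u" "s + 1"]
      by simp
    then show ?thesis
      unfolding dominated_def using * by (metis of_nat_eq_iff prod.inject)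
  qed
  moreover have "?S \<subseteq> grid n"
    unfolding grid_def using assms by (intro Sigma_mono image_mono) auto
  ultimately show ?thesis
    unfolding dominating_set_def grid_def by blast
qed

theorem theorem4:
  fixes n :: nat
  assumes "n \<ge> 3"
  shows "int (domination_number n) \<le> 2 * \<lceil>real n / 2\<rceil>"
proof -
  \<comment> \<open>From \<open>n\<close> \<ge> 3 it follows that \<open>m\<close> \<ge> 2 and that
    column \<open>m + 1\<close> lies in the grid.\<close>
  define m where "m = (n + 1) div 2"
  define S where "S = real ` {m, m + 1} \<times> real ` {2..m + 1}"
  have "dominating_set n S"
    unfolding S_def using assms by (intro dominating_set_two_columns) (auto simp: m_def)
  moreover have "card S = 2 * m"
    by (simp add: S_def card_cartesian_product card_image inj_on_def)
  ultimately have "domination_number n \<le> 2 * m"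
    unfolding domination_number_def by (intro Least_le) blast
  moreover have "int m = \<lceil>real n / 2\<rceil>"
    unfolding m_def by (rule sym, rule ceiling_unique; simp; linarith)
  ultimately show ?thesis
    by linarith
qed

end
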